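(* Fix $\theta\in(0,2\pi)^d$ and let $f_\varepsilon\in L^2(\Omega)$ be a sequence which $\theta$-quasi-periodic two-scale converges to some $f_0\in L^2(\Omega\times\square)$ as $\varepsilon\to0$. Let $u_\varepsilon\in H^1_0(\Omega)$ be the solution to $$-\operatorname{div}\big(a(\tfrac x\varepsilon)\nabla u_\varepsilon\big)+u_\varepsilon=f_\varepsilon\quad\text{in }\Omega.$$ Then $u_\varepsilon$ $\theta$-quasi-periodic two-scale converges to zero.
   Context: All functions are complex-valued; $\varepsilon>0$ runs along a sequence tending to $0$. $\Omega$ is a domain in $\mathbb R^d$, $d\ge1$, and $\square=(0,1)^d$. The symmetric matrix-valued function $a$ is measurable, $\square$-periodic, elliptic and bounded: there is $\nu>0$ with $\nu|\xi|^2\le a(y)\xi\cdot\overline\xi\le\nu^{-1}|\xi|^2$ for all $\xi\in\mathbb C^d$ and a.e. $y\in\square$. $C^\infty_\theta(\square)=\{e^{\mathrm i\theta\cdot y}\psi:\psi\text{ smooth and }\square\text{-periodic on }\mathbb R^d\}$. A bounded sequence $u_\varepsilon\in L^2(\Omega)$ $\theta$-quasi-periodic two-scale converges to $u\in L^2(\Omega\times\square)$ if $\lim_{\varepsilon\to0}\int_\Omega u_\varepsilon(x)\overline{\phi(x)\varphi(x/\varepsilon)}\,dx=\int_\Omega\int_\square u(x,y)\overline{\phi(x)\varphi(y)}\,dy\,dx$ for all $\phi\in C_0^\infty(\Omega)$, $\varphi\in C_\theta^\infty(\square)$. *)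

theory Defs
  imports "HOL-Analysis.Analysis"
begin

section \<open>Smooth functions\<close>

definition partial_deriv :: "'d \<Rightarrow> (real ^ 'd::finite \<Rightarrow> complex) \<Rightarrow> real ^ 'd \<Rightarrow> complex" where
  "partial_deriv i f x = frechet_derivative f (at x) (axis i 1)"

primrec Ck :: "nat \<Rightarrow> (real ^ 'd::finite \<Rightarrow> complex) \<Rightarrow> bool" where
  "Ck 0 f \<longleftrightarrow> continuous_on UNIV f"
| "Ck (Suc k) f \<longleftrightarrow> (\<forall>x. f differentiable (at x)) \<and> (\<forall>i. Ck k (partial_deriv i f))"

definition smooth :: "(real ^ 'd::finite \<Rightarrow> complex) \<Rightarrow> bool" where
  "smooth f \<longleftrightarrow> (\<forall>k. Ck k f)"

text \<open>Elements of \<open>C\<^sub>0\<^sup>\<infinity>(\<Omega>)\<close> are represented by their extension by zero to the whole space.\<close>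

definition test_functions :: "(real ^ 'd::finite) set \<Rightarrow> (real ^ 'd \<Rightarrow> complex) set" where
  "test_functions \<Omega> =
     {\<phi>. smooth \<phi> \<and> compact (closure {x. \<phi> x \<noteq> 0}) \<and> closure {x. \<phi> x \<noteq> 0} \<subseteq> \<Omega>}"

abbreviation unit_cell :: "(real ^ 'd::finite) set" where
  "unit_cell \<equiv> box 0 1"

definition cell_periodic :: "(real ^ 'd::finite \<Rightarrow> 'b) \<Rightarrow> bool" where
  "cell_periodic g \<longleftrightarrow> (\<forall>y i. g (y + axis i 1) = g y)"

definition quasi_periodic_smooth :: "real ^ 'd::finite \<Rightarrow> (real ^ 'd \<Rightarrow> complex) set" where
  "quasi_periodic_smooth \<theta> =
     {\<lambda>y. exp (\<i> * of_real (\<theta> \<bullet> y)) * \<psi> y | \<psi>. smooth \<psi> \<and> cell_periodic \<psi>}"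


section \<open>Lebesgue and Sobolev spaces\<close>

text \<open>
  Elements of function spaces on \<open>\<Omega>\<close> are total functions whose values outside \<open>\<Omega>\<close> are
  irrelevant; functions that agree almost everywhere are not identified.
\<close>

definition L2 :: "'a::euclidean_space set \<Rightarrow> ('a \<Rightarrow> 'b::euclidean_space) set" where
  "L2 \<Omega> = {u. u \<in> borel_measurable (lebesgue_on \<Omega>) \<and>
              integrable (lebesgue_on \<Omega>) (\<lambda>x. (norm (u x))\<^sup>2)}"

definition L2_norm :: "'a::euclidean_space set \<Rightarrow> ('a \<Rightarrow> 'b::euclidean_space) \<Rightarrow> real" where
  "L2_norm \<Omega> u = sqrt (LINT x|lebesgue_on \<Omega>. (norm (u x))\<^sup>2)"

definition is_weak_gradient ::
    "(real ^ 'd::finite) set \<Rightarrow> (real ^ 'd \<Rightarrow> complex) \<Rightarrow> (real ^ 'd \<Rightarrow> complex ^ 'd) \<Rightarrow> bool" where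
  "is_weak_gradient \<Omega> u G \<longleftrightarrow> G \<in> L2 \<Omega> \<and>
     (\<forall>i. \<forall>\<phi>\<in>test_functions \<Omega>.
        (LINT x|lebesgue_on \<Omega>. u x * partial_deriv i \<phi> x) = - (LINT x|lebesgue_on \<Omega>. G x $ i * \<phi> x))"

definition H1 :: "(real ^ 'd::finite) set \<Rightarrow> (real ^ 'd \<Rightarrow> complex) set" where
  "H1 \<Omega> = {u \<in> L2 \<Omega>. \<exists>G. is_weak_gradient \<Omega> u G}"

text \<open>For \<open>u \<in> H\<^sup>1(\<Omega>)\<close> the choice below is unique up to null sets.\<close>

definition weak_gradient ::
    "(real ^ 'd::finite) set \<Rightarrow> (real ^ 'd \<Rightarrow> complex) \<Rightarrow> real ^ 'd \<Rightarrow> complex ^ 'd" where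
  "weak_gradient \<Omega> u = (SOME G. is_weak_gradient \<Omega> u G)"

definition H1_norm :: "(real ^ 'd::finite) set \<Rightarrow> (real ^ 'd \<Rightarrow> complex) \<Rightarrow> real" where
  "H1_norm \<Omega> u = sqrt ((L2_norm \<Omega> u)\<^sup>2 + (L2_norm \<Omega> (weak_gradient \<Omega> u))\<^sup>2)"

definition H10 :: "(real ^ 'd::finite) set \<Rightarrow> (real ^ 'd \<Rightarrow> complex) set" where
  "H10 \<Omega> = {u \<in> H1 \<Omega>. \<exists>\<phi>. (\<forall>n. \<phi> n \<in> test_functions \<Omega>) \<and>
                          (\<lambda>n. H1_norm \<Omega> (\<lambda>x. u x - \<phi> n x)) \<longlonglongrightarrow> 0}"


section \<open>The equation\<close>

text \<open>The bilinear product \<open>\<xi> \<cdot> \<eta>\<close>; the library's inner product on \<open>\<complex>\<^sup>d\<close> is only real-valued.\<close>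

definition cdot :: "complex ^ 'd::finite \<Rightarrow> complex ^ 'd \<Rightarrow> complex" where
  "cdot \<xi> \<eta> = (\<Sum>i\<in>UNIV. \<xi> $ i * \<eta> $ i)"

definition cnj_vec :: "complex ^ 'd::finite \<Rightarrow> complex ^ 'd" where
  "cnj_vec \<xi> = (\<chi> i. cnj (\<xi> $ i))"

text \<open>
  The chain of inequalities for \<open>a(y)\<xi> \<cdot> cnj \<xi>\<close> includes that this number is real. Together with
  symmetry this forces the entries of \<open>a(y)\<close> to be real for almost every \<open>y\<close>.
\<close>

definition elliptic_periodic_matrix :: "real \<Rightarrow> (real ^ 'd::finite \<Rightarrow> complex ^ 'd ^ 'd) \<Rightarrow> bool" where
  "elliptic_periodic_matrix \<nu> a \<longleftrightarrow>
     a \<in> borel_measurable lebesgue \<and> cell_periodic a \<and>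
     (AE y in lebesgue_on unit_cell. transpose (a y) = a y) \<and>
     (AE y in lebesgue_on unit_cell. \<forall>\<xi>.
        cdot (a y *v \<xi>) (cnj_vec \<xi>) \<in> \<real> \<and>
        \<nu> * (norm \<xi>)\<^sup>2 \<le> Re (cdot (a y *v \<xi>) (cnj_vec \<xi>)) \<and>
        Re (cdot (a y *v \<xi>) (cnj_vec \<xi>)) \<le> inverse \<nu> * (norm \<xi>)\<^sup>2)"

text \<open>Weak solutions in \<open>H\<^sub>0\<^sup>1(\<Omega>)\<close> of \<open>- div (A \<nabla>u) + u = f\<close>.\<close>

definition weak_solution ::
    "(real ^ 'd::finite) set \<Rightarrow> (real ^ 'd \<Rightarrow> complex ^ 'd ^ 'd) \<Rightarrow> (real ^ 'd \<Rightarrow> complex) \<Rightarrow>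
     (real ^ 'd \<Rightarrow> complex) \<Rightarrow> bool" where
  "weak_solution \<Omega> A f u \<longleftrightarrow> u \<in> H10 \<Omega> \<and>
     (\<forall>v\<in>H10 \<Omega>.
        (LINT x|lebesgue_on \<Omega>. cdot (A x *v weak_gradient \<Omega> u x) (cnj_vec (weak_gradient \<Omega> v x)))
          + (LINT x|lebesgue_on \<Omega>. u x * cnj (v x))
        = (LINT x|lebesgue_on \<Omega>. f x * cnj (v x)))"


section \<open>Quasi-periodic two-scale convergence\<close>

definition two_scale_converges ::
    "real ^ 'd::finite \<Rightarrow> (real ^ 'd) set \<Rightarrow> (nat \<Rightarrow> real) \<Rightarrow> (nat \<Rightarrow> real ^ 'd \<Rightarrow> complex) \<Rightarrow>
     ((real ^ 'd) \<times> (real ^ 'd) \<Rightarrow> complex) \<Rightarrow> bool" where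
  "two_scale_converges \<theta> \<Omega> \<epsilon> u u\<^sub>0 \<longleftrightarrow>
     (\<forall>n. u n \<in> L2 \<Omega>) \<and> (\<exists>C. \<forall>n. L2_norm \<Omega> (u n) \<le> C) \<and>
     u\<^sub>0 \<in> L2 (\<Omega> \<times> unit_cell) \<and>
     (\<forall>\<phi>\<in>test_functions \<Omega>. \<forall>\<omega>\<in>quasi_periodic_smooth \<theta>.
        (\<lambda>n. LINT x|lebesgue_on \<Omega>. u n x * cnj (\<phi> x * \<omega> (x /\<^sub>R \<epsilon> n)))
          \<longlonglongrightarrow> (LINT x|lebesgue_on \<Omega>. LINT y|lebesgue_on unit_cell. u\<^sub>0 (x, y) * cnj (\<phi> x * \<omega> y)))"

end

theory Submission imports Defs begin

text \<open>
  Since \<open>\<theta>\<^sub>i \<in> (0, 2\<pi>)\<close>, every \<open>\<theta>\<close>-quasi-periodic function \<open>\<omega>\<close> is the \<open>i\<close>-th partial derivative of a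
  bounded smooth function, namely of
  \<open>w(y) = (exp(\<i>\<theta>\<^sub>i) - 1)\<^sup>-\<^sup>1 \<integral> \<omega>(y + t e\<^sub>i) dt\<close>, the integral being over \<open>[0, 1]\<close>. Thus
  \<open>\<omega>(x/\<epsilon>) = \<epsilon> \<partial>\<^sub>i (w(x/\<epsilon>))\<close>, and integration by parts against \<open>u\<^sub>\<epsilon>\<close>, which is bounded in \<open>H\<^sup>1\<close> by the
  energy estimate, shows that the oscillating integral is \<open>O(\<epsilon>)\<close>.
\<close>

section \<open>Calculus of partial derivatives and the classes \<open>Ck\<close>\<close>

lemma frechet_derivative_eq_sum_partial_deriv:
  fixes f :: "real ^ 'd::finite \<Rightarrow> complex"
  assumes "f differentiable (at x)"
  shows "frechet_derivative f (at x) v = (\<Sum>i\<in>UNIV. (v $ i) *\<^sub>R partial_deriv i f x)"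
proof -
  interpret linear "frechet_derivative f (at x)"
    using assms frechet_derivative_works has_derivative_linear by blast
  have "(\<Sum>i\<in>UNIV. (v $ i) *\<^sub>R axis i 1) = v"
    using basis_expansion[of v] by (simp add: scalar_mult_eq_scaleR)
  then have "frechet_derivative f (at x) v = frechet_derivative f (at x) (\<Sum>i\<in>UNIV. (v $ i) *\<^sub>R axis i 1)"
    by simp
  also have "\<dots> = (\<Sum>i\<in>UNIV. (v $ i) *\<^sub>R partial_deriv i f x)"
    by (simp only: sum scale partial_deriv_def)
  finally show ?thesis .
qed

lemma partial_deriv_at:
  assumes "(f has_derivative f') (at x)"
  shows "partial_deriv i f x = f' (axis i 1)"
  using assms frechet_derivative_at[OF assms] by (simp add: partial_deriv_def)

lemma Ck_imp_continuous: "Ck k f \<Longrightarrow> continuous_on UNIV f"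
  by (cases k) (auto intro!: continuous_at_imp_continuous_on differentiable_imp_continuous_within)

text \<open>The recursion puts conditions on the partial derivatives only, so monotonicity in the
  order is not built in. It rests on the base case, where differentiability gives continuity, and is
  then passed on through the partial derivatives.\<close>

lemma Ck_SucD: "Ck (Suc k) f \<Longrightarrow> Ck k f"
proof (induction k arbitrary: f)
  case 0
  then show ?case using Ck_imp_continuous[of "Suc 0"] by simp
next
  case (Suc k)
  then show ?case by simp
qed

text \<open>By uniqueness of the Frechet derivative, any family \<open>f'\<close> found by
  differentiation rules yields the partial derivatives. The closure properties below thus reduce to
  one derivative formula plus the induction hypothesis.\<close>

lemma Ck_SucI:
  assumes "\<And>x. (f has_derivative f' x) (at x)" "\<And>i. Ck k (\<lambda>x. f' x (axis i 1))"
  shows "Ck (Suc k) f"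
proof -
  have "partial_deriv i f = (\<lambda>x. f' x (axis i 1))" for i
    using partial_deriv_at[OF assms(1)] by auto
  with assms show ?thesis by (auto simp: differentiable_def)
qed

lemma Ck_const: "Ck k (\<lambda>_. c)"
proof (induction k arbitrary: c)
  case (Suc k)
  show ?case by (rule Ck_SucI[where f'="\<lambda>_ _. 0"]) (auto intro: Suc)
qed simp

lemma Ck_has_derivative: "Ck (Suc k) f \<Longrightarrow> (f has_derivative frechet_derivative f (at x)) (at x)"
  using frechet_derivative_works by auto

lemma Ck_Suc_partial: "Ck (Suc k) f \<Longrightarrow> Ck k (\<lambda>x. frechet_derivative f (at x) (axis i 1))"
  by (auto simp: partial_deriv_def[abs_def])

lemma Ck_add: "Ck k f \<Longrightarrow> Ck k g \<Longrightarrow> Ck k (\<lambda>x. f x + g x)"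
proof (induction k arbitrary: f g)
  case (Suc k)
  have "((\<lambda>x. f x + g x) has_derivative
      (\<lambda>h. frechet_derivative f (at x) h + frechet_derivative g (at x) h)) (at x)" for x
    by (intro has_derivative_add Ck_has_derivative[where k=k] Suc.prems)
  then show ?case
    by (rule Ck_SucI) (rule Suc.IH[OF Ck_Suc_partial[OF Suc.prems(1)] Ck_Suc_partial[OF Suc.prems(2)]])
qed (auto intro: continuous_on_add)

lemma Ck_mult: "Ck k f \<Longrightarrow> Ck k g \<Longrightarrow> Ck k (\<lambda>x. f x * g x)"
proof (induction k arbitrary: f g)
  case (Suc k)
  have D: "((\<lambda>x. f x * g x) has_derivative
      (\<lambda>h. f x * frechet_derivative g (at x) h + frechet_derivative f (at x) h * g x)) (at x)" for x
    by (intro has_derivative_mult Ck_has_derivative[where k=k] Suc.prems)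
  \<comment> \<open>Each term of the product rule pairs a derivative of order \<open>k\<close> with
    an undifferentiated factor, whose order is lowered from \<open>Suc k\<close> to \<open>k\<close>
    before the induction hypothesis is used.\<close>
  have "Ck k (\<lambda>x. f x * frechet_derivative g (at x) (axis i 1))"
    "Ck k (\<lambda>x. frechet_derivative f (at x) (axis i 1) * g x)" for i
    using Suc.prems by (auto intro!: Suc.IH dest: Ck_Suc_partial Ck_SucD simp del: Ck.simps)
  then show ?case
    by (intro Ck_SucI[OF D] Ck_add)
qed (auto intro: continuous_on_mult)

lemma Ck_cnj: "Ck k f \<Longrightarrow> Ck k (\<lambda>x. cnj (f x))"
proof (induction k arbitrary: f)
  case (Suc k)
  have "((\<lambda>x. cnj (f x)) has_derivative (\<lambda>h. cnj (frechet_derivative f (at x) h))) (at x)" for x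
    by (intro has_derivative_cnj Ck_has_derivative[where k=k] Suc.prems)
  then show ?case
    by (rule Ck_SucI) (rule Suc.IH[OF Ck_Suc_partial[OF Suc.prems]])
qed (auto intro: continuous_on_cnj)

text \<open>Chain rule for a dilation. The factor is written as a complex number so that the closure
  of \<open>Ck\<close> under products and constants applies to it; later \<open>c\<close> is the
  reciprocal of \<epsilon>.\<close>

lemma has_derivative_compose_scaleR:
  fixes f :: "real ^ 'd::finite \<Rightarrow> complex"
  assumes "f differentiable (at (c *\<^sub>R x))"
  shows "((\<lambda>x. f (c *\<^sub>R x)) has_derivative
            (\<lambda>h. of_real c * frechet_derivative f (at (c *\<^sub>R x)) h)) (at x)"
proof -
  have f: "(f has_derivative frechet_derivative f (at (c *\<^sub>R x))) (at (c *\<^sub>R x))"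
    using assms frechet_derivative_works by blast
  interpret linear "frechet_derivative f (at (c *\<^sub>R x))"
    using f by (rule has_derivative_linear)
  show ?thesis
    by (rule has_derivative_compose[where f="\<lambda>x. c *\<^sub>R x" and f'="\<lambda>h. c *\<^sub>R h", OF _ f, THEN has_derivative_eq_rhs])
      (auto simp: scale scaleR_conv_of_real[where 'a=complex] intro: derivative_intros)
qed

lemma Ck_compose_scaleR:
  fixes f :: "real ^ 'd::finite \<Rightarrow> complex"
  shows "Ck k f \<Longrightarrow> Ck k (\<lambda>x. f (c *\<^sub>R x))"
proof (induction k arbitrary: f)
  case 0
  then show ?case
    unfolding Ck.simps by (rule continuous_on_compose2) (auto intro: continuous_intros)
next
  case (Suc k)
  have "f differentiable (at x)" for x using Suc.prems by simp
  then show ?case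
    by (intro Ck_SucI) (rule has_derivative_compose_scaleR,
        auto intro!: Ck_mult Ck_const Suc.IH[OF Ck_Suc_partial[OF Suc.prems]])
qed

text \<open>Every partial derivative is the same exponential times the constant
  \<open>\<i> * \<theta> $ i\<close>, so the induction closes on the function itself.\<close>

lemma Ck_exp_inner: "Ck k (\<lambda>y. exp (\<i> * of_real (\<theta> \<bullet> y)))"
proof (induction k)
  case (Suc k)
  have "((\<lambda>y. exp (\<i> * of_real (\<theta> \<bullet> y))) has_derivative
          (\<lambda>h. exp (\<i> * of_real (\<theta> \<bullet> y)) * (\<i> * of_real (\<theta> \<bullet> h)))) (at y)" for y
  proof (rule has_derivative_compose[where f="\<lambda>y. \<i> * of_real (\<theta> \<bullet> y)" and f'="\<lambda>h. \<i> * of_real (\<theta> \<bullet> h)" and g=exp])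
    show "(exp has_derivative (*) (exp (\<i> * of_real (\<theta> \<bullet> y)))) (at (\<i> * complex_of_real (\<theta> \<bullet> y)))"
      using DERIV_exp by (simp add: has_field_derivative_def)
  qed (intro derivative_intros)
  then show ?case by (rule Ck_SucI) (intro Ck_mult Suc Ck_const)
next
  case 0
  show ?case unfolding Ck.simps by (intro continuous_intros)
qed

section \<open>Averages over a segment\<close>

text \<open>Differentiation under the integral sign, justified by continuity of the full derivative
  in all variables.\<close>

lemma integral_shift_has_derivative:
  fixes f :: "real ^ 'd::finite \<Rightarrow> complex"
  assumes "Ck (Suc 0) f"
  shows "((\<lambda>y. integral {0..1} (\<lambda>t. f (y + t *\<^sub>R e))) has_derivative
           (\<lambda>h. \<Sum>i\<in>UNIV. (h $ i) *\<^sub>R integral {0..1} (\<lambda>t. partial_deriv i f (y + t *\<^sub>R e)))) (at y)"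
proof -
  \<comment> \<open>The Leibniz rule asks for the derivative as a continuous map into bounded linear
    operators. Assembling \<open>D\<close> from the partial derivatives reduces its continuity to
    theirs.\<close>
  define D :: "real ^ 'd \<Rightarrow> (real ^ 'd) \<Rightarrow>\<^sub>L complex" where
    "D y = (\<Sum>i\<in>UNIV. blinfun_scaleR_left (partial_deriv i f y) o\<^sub>L blinfun_inner_left (axis i 1))" for y
  have f: "f differentiable (at x)" for x using assms by simp
  have cf: "continuous_on S f" for S
    using Ck_imp_continuous[OF assms] continuous_on_subset by blast
  have cp: "continuous_on S (partial_deriv i f)" for i S
    using assms by (auto intro: continuous_on_subset)
  have D: "D y h = (\<Sum>i\<in>UNIV. (h $ i) *\<^sub>R partial_deriv i f y)" for y h
    by (simp add: D_def blinfun.sum_left inner_axis)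
  have Df: "(f has_derivative D y) (at y)" for y
    using f[of y] unfolding frechet_derivative_works
    by (rule has_derivative_eq_rhs) (auto simp: frechet_derivative_eq_sum_partial_deriv[OF f] D)
  have cD: "continuous_on S D" for S
    unfolding D_def by (intro continuous_intros cp)
  have "((\<lambda>y. integral (cbox 0 1) (\<lambda>t. f (y + t *\<^sub>R e))) has_derivative
           integral (cbox 0 1) (\<lambda>t. D (y + t *\<^sub>R e))) (at y within UNIV)"
  proof (rule leibniz_rule)
    fix x :: "real ^ 'd" and t :: real
    show "((\<lambda>x. f (x + t *\<^sub>R e)) has_derivative D (x + t *\<^sub>R e)) (at x within UNIV)"
      by (rule has_derivative_compose[where f="\<lambda>x. x + t *\<^sub>R e" and f'="\<lambda>h. h", OF _ Df])
        (auto intro!: derivative_eq_intros)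
  next
    show "(\<lambda>t. f (x + t *\<^sub>R e)) integrable_on cbox 0 1" for x
      by (intro integrable_continuous continuous_on_compose2[OF cf[of UNIV]] continuous_intros) auto
    show "continuous_on (UNIV \<times> cbox 0 1) (\<lambda>(x, t). D (x + t *\<^sub>R e))"
      unfolding case_prod_beta
      by (intro continuous_on_compose2[OF cD[of UNIV]] continuous_intros) auto
  qed auto
  moreover have "integral (cbox 0 1) (\<lambda>t. D (y + t *\<^sub>R e)) h
     = (\<Sum>i\<in>UNIV. (h $ i) *\<^sub>R integral {0..1} (\<lambda>t. partial_deriv i f (y + t *\<^sub>R e)))" for h
  proof -
    have "(\<lambda>t. D (y + t *\<^sub>R e)) integrable_on cbox 0 1"
      by (intro integrable_continuous continuous_on_compose2[OF cD[of UNIV]] continuous_intros) auto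
    moreover have "(\<lambda>t. partial_deriv i f (y + t *\<^sub>R e)) integrable_on {0..1}" for i
      by (intro integrable_continuous_interval continuous_on_compose2[OF cp[of UNIV]] continuous_intros) auto
    ultimately show ?thesis
      by (simp add: blinfun_apply_integral D integral_sum integrable_cmul)
  qed
  ultimately show ?thesis by (auto elim!: has_derivative_eq_rhs)
qed

lemma partial_deriv_integral_shift:
  fixes f :: "real ^ 'd::finite \<Rightarrow> complex"
  assumes "Ck (Suc 0) f"
  shows "partial_deriv i (\<lambda>y. integral {0..1} (\<lambda>t. f (y + t *\<^sub>R e))) y
           = integral {0..1} (\<lambda>t. partial_deriv i f (y + t *\<^sub>R e))"
proof -
  have "(\<Sum>j\<in>UNIV. (axis i 1 $ j) *\<^sub>R integral {0..1} (\<lambda>t. partial_deriv j f (y + t *\<^sub>R e)))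
      = (\<Sum>j\<in>UNIV. if j = i then integral {0..1} (\<lambda>t. partial_deriv j f (y + t *\<^sub>R e)) else 0)"
    by (intro sum.cong) (auto simp: axis_def)
  then show ?thesis by (simp add: partial_deriv_at[OF integral_shift_has_derivative[OF assms]])
qed

text \<open>Averaging commutes with partial derivatives, so the induction hypothesis applies to
  \<open>partial_deriv i f\<close> in place of \<open>f\<close>.\<close>

lemma Ck_integral_shift:
  fixes f :: "real ^ 'd::finite \<Rightarrow> complex"
  shows "Ck k f \<Longrightarrow> Ck k (\<lambda>y. integral {0..1} (\<lambda>t. f (y + t *\<^sub>R e)))"
proof (induction k arbitrary: f)
  case 0
  then have "continuous_on (UNIV \<times> cbox 0 1) (\<lambda>(y, t::real). f (y + t *\<^sub>R e))"
    unfolding case_prod_beta by (auto intro!: continuous_on_compose2[of UNIV f] continuous_intros)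
  from integral_continuous_on_param[OF this] show ?case by simp
next
  case (Suc k)
  have f: "Ck (Suc 0) f" using Suc.prems by (auto dest: Ck_imp_continuous)
  have "(\<lambda>y. integral {0..1} (\<lambda>t. f (y + t *\<^sub>R e))) differentiable (at y)" for y
    using integral_shift_has_derivative[OF f] by (rule differentiableI)
  moreover have "Ck k (partial_deriv i (\<lambda>y. integral {0..1} (\<lambda>t. f (y + t *\<^sub>R e))))" for i
    using Suc by (simp add: partial_deriv_integral_shift[OF f, abs_def])
  ultimately show ?case by simp
qed

text \<open>When the segment points along the direction of differentiation, the integrand is the
  derivative in \<open>t\<close> of \<open>f\<close> along the segment, and the fundamental theorem
  of calculus leaves the endpoint difference.\<close>

lemma partial_deriv_integral_shift_axis:
  fixes f :: "real ^ 'd::finite \<Rightarrow> complex"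
  assumes "Ck (Suc 0) f"
  shows "partial_deriv i (\<lambda>y. integral {0..1} (\<lambda>t. f (y + t *\<^sub>R axis i 1))) y = f (y + axis i 1) - f y"
proof -
  have "((\<lambda>t. f (y + t *\<^sub>R axis i 1)) has_vector_derivative partial_deriv i f (y + t *\<^sub>R axis i 1))
          (at t within {0..1})" for t
  proof -
    have f: "(f has_derivative frechet_derivative f (at (y + t *\<^sub>R axis i 1))) (at (y + t *\<^sub>R axis i 1))"
      using assms by (rule Ck_has_derivative)
    interpret linear "frechet_derivative f (at (y + t *\<^sub>R axis i 1))"
      using f by (rule has_derivative_linear)
    show ?thesis
      unfolding has_vector_derivative_def partial_deriv_def
      by (rule has_derivative_compose[where f="\<lambda>t. y + t *\<^sub>R axis i 1" and f'="\<lambda>t. t *\<^sub>R axis i 1", OF _ f, THEN has_derivative_eq_rhs])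
        (auto intro!: derivative_eq_intros simp: scale)
  qed
  then have "((\<lambda>t. partial_deriv i f (y + t *\<^sub>R axis i 1)) has_integral
      f (y + 1 *\<^sub>R axis i 1) - f (y + 0 *\<^sub>R axis i 1)) {0..1}"
    by (intro fundamental_theorem_of_calculus) auto
  then show ?thesis
    by (simp add: partial_deriv_integral_shift[OF assms] integral_unique)
qed

section \<open>Periodicity, null sets and dilations\<close>

lemma cell_periodic_axis_shift:
  assumes "cell_periodic g"
  shows "g (y + of_int k *\<^sub>R axis i 1) = g y"
proof -
  have nat: "g (y + real n *\<^sub>R axis i 1) = g y" for n y
  proof (induction n)
    case (Suc n)
    have "g (y + real (Suc n) *\<^sub>R axis i 1) = g ((y + real n *\<^sub>R axis i 1) + axis i 1)"
      by (simp add: algebra_simps)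
    with assms Suc show ?case by (simp add: cell_periodic_def)
  qed simp
  show ?thesis
  proof (cases k rule: int_cases2)
    case (nonneg n)
    then show ?thesis using nat by simp
  next
    case (nonpos n)
    \<comment> \<open>A negative shift is undone by a positive one: the natural-number case is
      applied at the already shifted point.\<close>
    then show ?thesis using nat[of "y + of_int k *\<^sub>R axis i 1" n] by simp
  qed
qed

lemma cell_periodic_shift:
  fixes g :: "real ^ 'd::finite \<Rightarrow> 'b"
  assumes "cell_periodic g" "\<And>i. z $ i \<in> \<int>"
  shows "g (y + z) = g y"
proof -
  have "g (y + (\<Sum>i\<in>S. (z $ i) *\<^sub>R axis i 1)) = g y" if "finite S" for S :: "'d set"
    using that
  proof (induction S)
    case (insert i S)
    obtain k where "z $ i = of_int k" using assms(2) Ints_cases by blast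
    with insert cell_periodic_axis_shift[OF assms(1), of "y + (\<Sum>i\<in>S. (z $ i) *\<^sub>R axis i 1)" k i]
    show ?case by (simp add: algebra_simps)
  qed simp
  from this[of UNIV] show ?thesis
    using basis_expansion[of z] by (simp add: scalar_mult_eq_scaleR)
qed

text \<open>Subtracting the integer parts of the coordinates moves any point into the closed unit
  cube, where compactness bounds \<open>g\<close>.\<close>

lemma cell_periodic_bounded:
  fixes g :: "real ^ 'd::finite \<Rightarrow> complex"
  assumes "continuous_on UNIV g" "cell_periodic g"
  obtains M where "\<And>y. norm (g y) \<le> M"
proof -
  have "bounded (g ` cbox 0 1)"
    using assms(1) by (intro compact_imp_bounded compact_continuous_image)
      (auto intro: continuous_on_subset)
  then obtain M where M: "\<And>y. y \<in> cbox 0 1 \<Longrightarrow> norm (g y) \<le> M"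
    by (auto simp: bounded_iff)
  have "norm (g y) \<le> M" for y
  proof -
    define z :: "real ^ 'd" where "z = (\<chi> i. of_int \<lfloor>y $ i\<rfloor>)"
    have "y - z \<in> cbox 0 1"
      by (auto simp: mem_box_cart z_def) linarith
    moreover have "g (y - z + z) = g (y - z)"
      by (rule cell_periodic_shift[OF assms(2)]) (simp add: z_def)
    ultimately show ?thesis using M by force
  qed
  with that show thesis by blast
qed

text \<open>Lebesgue measure is complete, so the exceptional set itself can replace a measurable
  null set containing it.\<close>

lemma AE_lebesgue_iff_negligible: "(AE x in lebesgue. P x) \<longleftrightarrow> negligible {x. \<not> P x}"
proof -
  have "(AE x in lebesgue. P x) \<longleftrightarrow> (\<exists>N. negligible N \<and> {x. \<not> P x} \<subseteq> N)"
    by (simp add: eventually_ae_filter negligible_iff_null_sets Bex_def)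
  then show ?thesis using negligible_subset by blast
qed

text \<open>The space is the union of countably many integer translates of the open cell and the
  hyperplanes on which some coordinate is an integer. Both the translated exceptional sets and the
  hyperplanes are null.\<close>

lemma cell_periodic_AE:
  fixes P :: "real ^ 'd::finite \<Rightarrow> bool"
  assumes "AE y in lebesgue_on unit_cell. P y" "cell_periodic P"
  shows "AE y in lebesgue. P y"
proof -
  define Z :: "(real ^ 'd) set" where "Z = {z. \<forall>i. z $ i \<in> \<int>}"
  define N where "N = {y \<in> unit_cell. \<not> P y}"
  have "AE y in lebesgue. y \<in> unit_cell \<longrightarrow> P y"
    using assms(1) by (subst (asm) AE_restrict_space_iff) auto
  then have "negligible N"
    by (simp add: N_def AE_lebesgue_iff_negligible)
  have "countable Z"
    unfolding Z_def by (rule countable_vector) (auto simp: Ints_def)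
  have "negligible {y. y $ i = c}" for i :: 'd and c :: real
    using negligible_standard_hyperplane[of "axis i 1 :: real ^ 'd" c]
    by (simp add: inner_axis axis_in_Basis_iff)
  then have "negligible ((\<Union>z\<in>Z. (+) z ` N) \<union> (\<Union>i. \<Union>c\<in>\<int>. {y. y $ i = c}))"
    using \<open>countable Z\<close> \<open>negligible N\<close>
    by (intro negligible_Un negligible_countable_Union countable_image)
      (auto simp: negligible_translation Ints_def)
  moreover have "{y. \<not> P y} \<subseteq> (\<Union>z\<in>Z. (+) z ` N) \<union> (\<Union>i. \<Union>c\<in>\<int>. {y. y $ i = c})"
  proof (clarify, rule ccontr)
    fix y assume "\<not> P y" and n: "y \<notin> (\<Union>i. \<Union>c\<in>\<int>. {y. y $ i = c})"
      and nN: "y \<notin> (\<Union>z\<in>Z. (+) z ` N)"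
    define z :: "real ^ 'd" where "z = (\<chi> i. of_int \<lfloor>y $ i\<rfloor>)"
    have "z \<in> Z" by (simp add: z_def Z_def)
    \<comment> \<open>Off the hyperplanes all fractional parts are strictly positive, so subtracting
      the integer parts lands in the open cell and not merely in its closure.\<close>
    have "y $ i \<noteq> of_int \<lfloor>y $ i\<rfloor>" for i
      using n Ints_of_int[of "\<lfloor>y $ i\<rfloor>"] by blast
    then have "0 < y $ i - of_int \<lfloor>y $ i\<rfloor>" for i
      by (metis diff_gt_0_iff_gt of_int_floor_le order_le_less)
    moreover have "y $ i - of_int \<lfloor>y $ i\<rfloor> < 1" for i
      by linarith
    ultimately have "y - z \<in> unit_cell"
      by (auto simp: mem_box_cart z_def)
    moreover have "P (y - z + z) = P (y - z)"
      using \<open>z \<in> Z\<close> by (intro cell_periodic_shift[OF assms(2)]) (simp add: Z_def)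
    ultimately have "y - z \<in> N"
      using \<open>\<not> P y\<close> by (simp add: N_def)
    then have "y \<in> (+) z ` N" by (intro image_eqI[of _ _ "y - z"]) auto
    with nN \<open>z \<in> Z\<close> show False by blast
  qed
  ultimately have "negligible {y. \<not> P y}"
    using negligible_subset by blast
  then show ?thesis
    by (simp add: AE_lebesgue_iff_negligible)
qed

text \<open>A dilation is differentiable and therefore maps null sets to null sets. This carries
  ellipticity from \<open>a\<close> to the rescaled coefficients.\<close>

lemma AE_lebesgue_on_scaleR:
  fixes P :: "real ^ 'd::finite \<Rightarrow> bool"
  assumes "AE y in lebesgue. P y" "e > 0" "S \<in> sets lebesgue"
  shows "AE x in lebesgue_on S. P (x /\<^sub>R e)"
proof -
  have "negligible {y. \<not> P y}"
    using assms(1) by (simp add: AE_lebesgue_iff_negligible)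
  then have "negligible ((\<lambda>x. e *\<^sub>R x) ` {y. \<not> P y})"
    by (rule negligible_differentiable_image_negligible[OF order_refl])
      (auto intro!: differentiable_on_scaleR)
  moreover have "{x. \<not> P (x /\<^sub>R e)} \<subseteq> (\<lambda>x. e *\<^sub>R x) ` {y. \<not> P y}"
    using assms(2) by (auto intro!: image_eqI[where x="_ /\<^sub>R e"])
  ultimately have "negligible {x. \<not> P (x /\<^sub>R e)}"
    using negligible_subset by blast
  then have "AE x in lebesgue. P (x /\<^sub>R e)"
    by (simp add: AE_lebesgue_iff_negligible)
  then show ?thesis
    using assms(3) by (subst AE_restrict_space_iff) auto
qed

section \<open>Test functions\<close>

text \<open>The support of \<open>g\<close> is a closed subset of a compact set. Products,
  conjugates and partial derivatives of test functions are all treated through this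
  criterion.\<close>

lemma test_functions_support:
  assumes "\<phi> \<in> test_functions \<Omega>" "smooth g" "{x. g x \<noteq> 0} \<subseteq> closure {x. \<phi> x \<noteq> 0}"
  shows "g \<in> test_functions \<Omega>"
proof -
  have "closure {x. g x \<noteq> 0} \<subseteq> closure {x. \<phi> x \<noteq> 0}"
    using assms(3) by (rule closure_minimal) simp
  moreover from this have "compact (closure {x. g x \<noteq> 0})"
    using assms(1) compact_Int_closed[OF _ closed_closure] unfolding test_functions_def
    by (metis (no_types, lifting) Int_absorb1 mem_Collect_eq)
  ultimately show ?thesis
    using assms(1,2) by (auto simp: test_functions_def)
qed

lemma smooth_mult: "smooth f \<Longrightarrow> smooth g \<Longrightarrow> smooth (\<lambda>x. f x * g x)"
  by (simp add: smooth_def Ck_mult)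

lemma smooth_cnj: "smooth f \<Longrightarrow> smooth (\<lambda>x. cnj (f x))"
  by (simp add: smooth_def Ck_cnj)

lemma smooth_compose_scaleR: "smooth f \<Longrightarrow> smooth (\<lambda>x. f (c *\<^sub>R x))"
  by (simp add: smooth_def Ck_compose_scaleR)

lemma smooth_partial_deriv: "smooth f \<Longrightarrow> smooth (partial_deriv i f)"
  unfolding smooth_def by (metis Ck.simps(2))

lemma smooth_has_derivative: "smooth f \<Longrightarrow> (f has_derivative frechet_derivative f (at x)) (at x)"
  unfolding smooth_def using Ck_has_derivative by blast

lemma smooth_continuous: "smooth f \<Longrightarrow> continuous_on UNIV f"
  unfolding smooth_def using Ck_imp_continuous by blast

lemma test_functions_smooth: "\<phi> \<in> test_functions \<Omega> \<Longrightarrow> smooth \<phi>"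
  by (simp add: test_functions_def)

text \<open>This admits oscillating factors such as \<open>w (x /\<^sub>R e)\<close>, which are
  smooth but need not have compact support.\<close>

lemma test_functions_mult_smooth:
  assumes "\<phi> \<in> test_functions \<Omega>" "smooth g"
  shows "(\<lambda>x. \<phi> x * g x) \<in> test_functions \<Omega>"
  using assms by (intro test_functions_support[OF assms(1)] smooth_mult)
    (auto simp: test_functions_smooth intro: closure_subset[THEN subsetD])

lemma test_functions_cnj:
  assumes "\<phi> \<in> test_functions \<Omega>"
  shows "(\<lambda>x. cnj (\<phi> x)) \<in> test_functions \<Omega>"
  using assms by (intro test_functions_support[OF assms] smooth_cnj)
    (auto simp: test_functions_smooth intro: closure_subset[THEN subsetD])

text \<open>The complement of the support is open and \<phi> vanishes on it, so the derivative
  vanishes there too.\<close>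

lemma test_functions_partial_deriv:
  assumes "\<phi> \<in> test_functions \<Omega>"
  shows "partial_deriv i \<phi> \<in> test_functions \<Omega>"
proof (rule test_functions_support[OF assms])
  show "smooth (partial_deriv i \<phi>)"
    using assms by (simp add: smooth_partial_deriv test_functions_smooth)
  have "partial_deriv i \<phi> x = 0" if "x \<in> - closure {x. \<phi> x \<noteq> 0}" for x
  proof -
    have "(\<phi> has_derivative (\<lambda>_. 0)) (at x)"
    proof (rule has_derivative_transform_within_open[where f="\<lambda>_. 0"])
      show "0 = \<phi> x" if "x \<in> - closure {x. \<phi> x \<noteq> 0}" for x
        using that closure_subset[of "{x. \<phi> x \<noteq> 0}"] by auto
    qed (use that in auto)
    then show ?thesis by (rule partial_deriv_at)
  qed
  then show "{x. partial_deriv i \<phi> x \<noteq> 0} \<subseteq> closure {x. \<phi> x \<noteq> 0}" by blast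
qed

lemma test_functions_L2:
  assumes "\<phi> \<in> test_functions \<Omega>" "open \<Omega>"
  shows "\<phi> \<in> L2 \<Omega>"
proof -
  let ?K = "closure {x. \<phi> x \<noteq> 0}"
  have c: "continuous_on S \<phi>" for S
    using smooth_continuous[OF test_functions_smooth[OF assms(1)]] continuous_on_subset by blast
  then have m: "\<phi> \<in> borel_measurable borel"
    by (simp add: borel_measurable_continuous_onI)
  \<comment> \<open>The indicator of the support does not change the function; it brings in the
    integrability of continuous functions on compact sets.\<close>
  have "integrable lborel (\<lambda>x. indicator ?K x *\<^sub>R (norm (\<phi> x))\<^sup>2)"
    using assms(1) by (intro borel_integrable_compact continuous_intros c) (simp add: test_functions_def)
  moreover have "(\<lambda>x. indicator ?K x *\<^sub>R (norm (\<phi> x))\<^sup>2) = (\<lambda>x. (norm (\<phi> x))\<^sup>2)"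
    using closure_subset[of "{x. \<phi> x \<noteq> 0}"] by (auto simp: indicator_def fun_eq_iff)
  ultimately have "integrable lebesgue (\<lambda>x. (norm (\<phi> x))\<^sup>2)"
    using m by (simp add: integrable_completion)
  moreover have "\<phi> \<in> borel_measurable lebesgue"
    using m by (simp add: measurable_completion)
  ultimately show ?thesis
    using assms(2) unfolding L2_def
    by (auto simp: integrable_restrict_space measurable_restrict_space1
        simp del: real_scaleR_def intro!: integrable_mult_indicator)
qed

section \<open>Estimates in \<open>L2\<close>\<close>

lemma L2_norm_power2: "(L2_norm \<Omega> u)\<^sup>2 = (LINT x|lebesgue_on \<Omega>. (norm (u x))\<^sup>2)"
  by (simp add: L2_norm_def)

lemma L2_mono:
  fixes g :: "'a::euclidean_space \<Rightarrow> 'b::euclidean_space" and h :: "'a \<Rightarrow> 'c::euclidean_space"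
  assumes "h \<in> L2 \<Omega>" "g \<in> borel_measurable (lebesgue_on \<Omega>)"
    and "\<And>x. norm (g x) \<le> M * norm (h x)"
  shows "g \<in> L2 \<Omega>" "(L2_norm \<Omega> g)\<^sup>2 \<le> M\<^sup>2 * (L2_norm \<Omega> h)\<^sup>2"
proof -
  have h: "integrable (lebesgue_on \<Omega>) (\<lambda>x. M\<^sup>2 * (norm (h x))\<^sup>2)"
    using assms(1) by (simp add: L2_def)
  have le: "(norm (g x))\<^sup>2 \<le> M\<^sup>2 * (norm (h x))\<^sup>2" for x
    using power_mono[OF assms(3)[of x], of 2] by (simp add: power_mult_distrib)
  have g: "integrable (lebesgue_on \<Omega>) (\<lambda>x. (norm (g x))\<^sup>2)"
    by (rule Bochner_Integration.integrable_bound[OF h]) (use assms(2) le in auto)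
  with assms(2) show "g \<in> L2 \<Omega>" by (simp add: L2_def)
  show "(L2_norm \<Omega> g)\<^sup>2 \<le> M\<^sup>2 * (L2_norm \<Omega> h)\<^sup>2"
    using integral_mono[OF g h le] by (simp add: L2_norm_power2)
qed

lemma L2_cnj: "g \<in> L2 \<Omega> \<Longrightarrow> (\<lambda>x. cnj (g x)) \<in> L2 \<Omega>"
  unfolding L2_def by (auto intro: borel_measurable_continuous_on[of cnj] continuous_intros)

text \<open>Young's inequality, that a product is at most half the sum of the squares, is used
  pointwise. It gives integrability and the bound together, in a form whose terms can be absorbed in
  the energy estimate.\<close>

lemma L2_mult:
  fixes g h :: "'a::euclidean_space \<Rightarrow> complex"
  assumes "g \<in> L2 \<Omega>" "h \<in> L2 \<Omega>"
  shows "integrable (lebesgue_on \<Omega>) (\<lambda>x. g x * h x)"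
    and "norm (LINT x|lebesgue_on \<Omega>. g x * h x) \<le> ((L2_norm \<Omega> g)\<^sup>2 + (L2_norm \<Omega> h)\<^sup>2) / 2"
proof -
  have gm [measurable]: "g \<in> borel_measurable (lebesgue_on \<Omega>)" "h \<in> borel_measurable (lebesgue_on \<Omega>)"
    and g: "integrable (lebesgue_on \<Omega>) (\<lambda>x. (norm (g x))\<^sup>2)"
    and h: "integrable (lebesgue_on \<Omega>) (\<lambda>x. (norm (h x))\<^sup>2)"
    using assms by (auto simp: L2_def)
  let ?b = "\<lambda>x. ((norm (g x))\<^sup>2 + (norm (h x))\<^sup>2) / 2"
  have b: "integrable (lebesgue_on \<Omega>) ?b"
    using g h by simp
  have le: "norm (g x * h x) \<le> ?b x" for x
    using sum_squares_bound[of "norm (g x)" "norm (h x)"] by (simp add: norm_mult ac_simps)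
  show i: "integrable (lebesgue_on \<Omega>) (\<lambda>x. g x * h x)"
    by (rule Bochner_Integration.integrable_bound[OF b]) (use le in auto)
  have "norm (LINT x|lebesgue_on \<Omega>. g x * h x) \<le> (LINT x|lebesgue_on \<Omega>. norm (g x * h x))"
    by simp
  also have "\<dots> \<le> (LINT x|lebesgue_on \<Omega>. ?b x)"
    using i b le by (intro integral_mono) auto
  also have "\<dots> = ((L2_norm \<Omega> g)\<^sup>2 + (L2_norm \<Omega> h)\<^sup>2) / 2"
    using g h by (simp add: L2_norm_power2)
  finally show "norm (LINT x|lebesgue_on \<Omega>. g x * h x) \<le> ((L2_norm \<Omega> g)\<^sup>2 + (L2_norm \<Omega> h)\<^sup>2) / 2" .
qed

section \<open>Weak gradients and the energy estimate\<close>

text \<open>Membership in \<open>H1\<close> supplies the existence that the choice operator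
  needs.\<close>

lemma weak_gradient: "u \<in> H1 \<Omega> \<Longrightarrow> is_weak_gradient \<Omega> u (weak_gradient \<Omega> u)"
  using someI_ex[of "is_weak_gradient \<Omega> u"]
  unfolding H1_def weak_gradient_def mem_Collect_eq by blast

lemma borel_measurable_cdot [measurable (raw)]:
  assumes "f \<in> borel_measurable M" "g \<in> borel_measurable M"
  shows "(\<lambda>x. cdot (f x) (g x)) \<in> borel_measurable M"
  unfolding cdot_def
  by (intro borel_measurable_sum borel_measurable_times assms[THEN measurable_compose] borel_measurable_continuous_onI continuous_intros)

lemma borel_measurable_cnj_vec [measurable (raw)]:
  "f \<in> borel_measurable M \<Longrightarrow> (\<lambda>x. cnj_vec (f x)) \<in> borel_measurable M"
  by (rule measurable_compose, assumption, intro borel_measurable_continuous_onI)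
    (auto simp: cnj_vec_def intro!: continuous_intros)

lemma borel_measurable_matrix_vector_mult [measurable (raw)]:
  fixes A :: "'a \<Rightarrow> complex ^ 'n::finite ^ 'm::finite"
  assumes "A \<in> borel_measurable M" "f \<in> borel_measurable M"
  shows "(\<lambda>x. A x *v f x) \<in> borel_measurable M"
proof -
  \<comment> \<open>Joint continuity in matrix and vector reduces the claim to measurability of the
    pair.\<close>
  have "continuous_on UNIV (\<lambda>p :: (complex ^ 'n ^ 'm) \<times> (complex ^ 'n). fst p *v snd p)"
    unfolding matrix_vector_mult_def by (intro continuous_intros)
  then show ?thesis
    using borel_measurable_continuous_Pair[OF assms, of "\<lambda>A v. A *v v"] by simp
qed

text \<open>
  The upper ellipticity bound makes the energy density integrable; without integrability the
  Bochner integral in the weak formulation would be the junk value 0.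
\<close>

lemma weak_solution_energy_bound:
  assumes u: "weak_solution \<Omega> A f u" and f: "f \<in> L2 \<Omega>"
    and [measurable]: "A \<in> borel_measurable (lebesgue_on \<Omega>)"
    and ell: "AE x in lebesgue_on \<Omega>. \<forall>\<xi>.
        cdot (A x *v \<xi>) (cnj_vec \<xi>) \<in> \<real> \<and>
        \<nu> * (norm \<xi>)\<^sup>2 \<le> Re (cdot (A x *v \<xi>) (cnj_vec \<xi>)) \<and>
        Re (cdot (A x *v \<xi>) (cnj_vec \<xi>)) \<le> inverse \<nu> * (norm \<xi>)\<^sup>2"
    and "\<nu> > 0"
  shows "2 * \<nu> * (L2_norm \<Omega> (weak_gradient \<Omega> u))\<^sup>2 + (L2_norm \<Omega> u)\<^sup>2 \<le> (L2_norm \<Omega> f)\<^sup>2"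
proof -
  define G where "G = weak_gradient \<Omega> u"
  let ?e = "\<lambda>x. cdot (A x *v G x) (cnj_vec (G x))"
  have "u \<in> H10 \<Omega>" using u by (simp add: weak_solution_def)
  then have "u \<in> H1 \<Omega>" by (simp add: H10_def)
  then have uL: "u \<in> L2 \<Omega>" and GL: "G \<in> L2 \<Omega>"
    using weak_gradient by (auto simp: H1_def is_weak_gradient_def G_def)
  have [measurable]: "G \<in> borel_measurable (lebesgue_on \<Omega>)" and
    G2: "integrable (lebesgue_on \<Omega>) (\<lambda>x. (norm (G x))\<^sup>2)"
    using GL by (auto simp: L2_def)
  have "integrable (lebesgue_on \<Omega>) (\<lambda>x. inverse \<nu> * (norm (G x))\<^sup>2)"
    using G2 by simp
  then have e: "integrable (lebesgue_on \<Omega>) ?e"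
  proof (rule Bochner_Integration.integrable_bound)
    show "AE x in lebesgue_on \<Omega>. norm (?e x) \<le> norm (inverse \<nu> * (norm (G x))\<^sup>2)"
      using ell
    proof eventually_elim
      case (elim x)
      then have "?e x \<in> \<real>" and le: "\<nu> * (norm (G x))\<^sup>2 \<le> Re (?e x)"
        "Re (?e x) \<le> inverse \<nu> * (norm (G x))\<^sup>2" by auto
      \<comment> \<open>The density is real, so its modulus is the absolute value of its real part;
        the lower bound makes that real part nonnegative.\<close>
      then have "norm (?e x) = \<bar>Re (?e x)\<bar>"
        by (simp add: in_Reals_norm complex_is_Real_iff cmod_eq_Re)
      moreover have "0 \<le> \<nu> * (norm (G x))\<^sup>2" using \<open>\<nu> > 0\<close> by simp
      ultimately show ?case using le by simp
    qed
  qed measurable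
  have "\<nu> * (L2_norm \<Omega> G)\<^sup>2 = (LINT x|lebesgue_on \<Omega>. \<nu> * (norm (G x))\<^sup>2)"
    by (simp add: L2_norm_power2)
  also have "\<dots> \<le> (LINT x|lebesgue_on \<Omega>. Re (?e x))"
    using ell e G2 by (intro integral_mono_AE) (auto simp: integrable_Re)
  also have "\<dots> = Re (LINT x|lebesgue_on \<Omega>. ?e x)"
    using e by simp
  finally have 1: "\<nu> * (L2_norm \<Omega> G)\<^sup>2 \<le> Re (LINT x|lebesgue_on \<Omega>. ?e x)" .
  have "(LINT x|lebesgue_on \<Omega>. u x * cnj (u x)) = of_real ((L2_norm \<Omega> u)\<^sup>2)"
    by (simp add: L2_norm_power2 complex_norm_square[symmetric] flip: integral_complex_of_real)
  \<comment> \<open>The equation is tested with the solution \<open>u\<close> itself.\<close>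
  with u \<open>u \<in> H10 \<Omega>\<close> have "(LINT x|lebesgue_on \<Omega>. ?e x) + of_real ((L2_norm \<Omega> u)\<^sup>2)
      = (LINT x|lebesgue_on \<Omega>. f x * cnj (u x))"
    by (auto simp: weak_solution_def G_def)
  from arg_cong[OF this, of Re]
  have "Re (LINT x|lebesgue_on \<Omega>. ?e x) + (L2_norm \<Omega> u)\<^sup>2 = Re (LINT x|lebesgue_on \<Omega>. f x * cnj (u x))"
    by (simp only: plus_complex.sel Re_complex_of_real)
  \<comment> \<open>Half of the squared norm of \<open>u\<close> is absorbed on the left;
    multiplying by 2 then produces the factor \<open>2 * \<nu>\<close>.\<close>
  moreover have "Re (LINT x|lebesgue_on \<Omega>. f x * cnj (u x)) \<le> ((L2_norm \<Omega> f)\<^sup>2 + (L2_norm \<Omega> u)\<^sup>2) / 2"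
    using order_trans[OF complex_Re_le_cmod L2_mult(2)[OF f L2_cnj[OF uL]]]
    by (simp only: L2_norm_def complex_mod_cnj)
  ultimately show ?thesis using 1 by (simp add: G_def)
qed

section \<open>Antiderivatives of quasi-periodic functions and oscillating integrals\<close>

text \<open>The average of \<omega> along the axis has derivative \<kappa> times \<omega>, so
  dividing by \<kappa> gives \<open>w\<close>. It is bounded because \<omega> has the same modulus
  as its periodic factor \<psi>.\<close>

lemma quasi_periodic_smooth_antiderivative:
  fixes \<theta> :: "real ^ 'd::finite"
  assumes "\<omega> \<in> quasi_periodic_smooth \<theta>" "0 < \<theta> $ i" "\<theta> $ i < 2 * pi"
  obtains w M where "smooth w" "\<And>y. norm (w y) \<le> M" "partial_deriv i w = \<omega>"
proof -
  obtain \<psi> where \<omega>: "\<omega> = (\<lambda>y. exp (\<i> * of_real (\<theta> \<bullet> y)) * \<psi> y)"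
    and \<psi>: "smooth \<psi>" "cell_periodic \<psi>"
    using assms(1) by (auto simp: quasi_periodic_smooth_def)
  have s: "smooth \<omega>"
    using \<psi> by (simp add: \<omega> smooth_def Ck_mult Ck_exp_inner)
  obtain M where "\<And>y. norm (\<psi> y) \<le> M"
    using cell_periodic_bounded[OF smooth_continuous[OF \<psi>(1)] \<psi>(2)] by blast
  then have M: "norm (\<omega> y) \<le> M" for y
    by (simp add: \<omega> norm_mult)
  define \<kappa> where "\<kappa> = exp (\<i> * of_real (\<theta> $ i)) - 1"
  \<comment> \<open>Here the strict bounds on \<open>\<theta> $ i\<close> enter: \<kappa> vanishes
    only at integer multiples of \<open>2 * pi\<close>.\<close>
  have "\<kappa> \<noteq> 0"
  proof
    assume "\<kappa> = 0"
    then obtain k :: int where k: "\<theta> $ i = of_int (2 * k) * pi"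
      by (auto simp: \<kappa>_def exp_eq_1)
    with assms(2,3) have "0 < k" "k < 1"
      by (auto simp: zero_less_mult_iff)
    then show False by simp
  qed
  have shift: "\<omega> (y + axis i 1) - \<omega> y = \<kappa> * \<omega> y" for y
    using \<psi>(2) by (simp add: \<omega> \<kappa>_def cell_periodic_def inner_add_right inner_axis exp_add algebra_simps)
  define W where "W y = integral {0..1} (\<lambda>t. \<omega> (y + t *\<^sub>R axis i 1))" for y
  have W: "smooth W"
    using s by (simp add: W_def[abs_def] smooth_def Ck_integral_shift)
  define w where "w y = inverse \<kappa> * W y" for y
  have "smooth w"
    using W by (simp add: w_def[abs_def] smooth_def Ck_mult Ck_const)
  moreover have "norm (w y) \<le> norm (inverse \<kappa>) * M" for y
  proof -
    have "(\<lambda>t. \<omega> (y + t *\<^sub>R axis i 1)) integrable_on {0..1}"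
      by (intro integrable_continuous_interval continuous_on_compose2[OF smooth_continuous[OF s]] continuous_intros) auto
    then have "norm (W y) \<le> integral {0..1} (\<lambda>t::real. M)"
      unfolding W_def using M by (intro integral_norm_bound_integral) auto
    then show ?thesis
      by (simp add: w_def norm_mult mult_left_mono)
  qed
  moreover have "partial_deriv i w = \<omega>"
  proof
    fix y
    have "partial_deriv i W y = \<kappa> * \<omega> y"
      using s by (simp add: W_def[abs_def] partial_deriv_integral_shift_axis smooth_def shift del: Ck.simps)
    moreover have "partial_deriv i w y = inverse \<kappa> * partial_deriv i W y"
      unfolding w_def[abs_def] partial_deriv_def[of i W]
      by (rule partial_deriv_at) (intro has_derivative_mult_right smooth_has_derivative W)
    ultimately show "partial_deriv i w y = \<omega> y"
      using \<open>\<kappa> \<noteq> 0\<close> by simp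
  qed
  ultimately show thesis by (rule that)
qed

text \<open>Differentiating \<phi> times the rescaled \<open>w\<close> gives a term of order
  \<open>1 / e\<close>, containing the oscillating factor of interest, and a bounded one.
  Integrating by parts and solving for the first term leaves a factor \<open>e\<close>, while the
  rescaled \<open>w\<close> stays bounded by \<open>M\<close>.\<close>

lemma oscillating_integral_bound:
  fixes \<Omega> :: "(real ^ 'd::finite) set"
  assumes "open \<Omega>" and u: "u \<in> H1 \<Omega>" and \<phi>: "\<phi> \<in> test_functions \<Omega>"
    and w: "smooth w" "\<And>y. norm (w y) \<le> M" and "e > 0"
  shows "norm (LINT x|lebesgue_on \<Omega>. u x * cnj (\<phi> x * partial_deriv i w (x /\<^sub>R e)))
    \<le> e * ((L2_norm \<Omega> (weak_gradient \<Omega> u))\<^sup>2 + (L2_norm \<Omega> u)\<^sup>2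
        + M\<^sup>2 * ((L2_norm \<Omega> \<phi>)\<^sup>2 + (L2_norm \<Omega> (partial_deriv i \<phi>))\<^sup>2)) / 2"
proof -
  define G where "G = weak_gradient \<Omega> u"
  define we where "we x = w (x /\<^sub>R e)" for x
  \<comment> \<open>The weak gradient is defined by a pairing without conjugation, so the conjugate
    is built into the test function \<open>g\<close> and the parts \<open>p\<close>,
    \<open>q\<close> of its derivative.\<close>
  define g where "g x = cnj (\<phi> x * we x)" for x
  define p where "p x = cnj (partial_deriv i \<phi> x * we x)" for x
  define q where "q x = cnj (\<phi> x * partial_deriv i w (x /\<^sub>R e))" for x
  have we: "smooth we"
    unfolding we_def[abs_def] by (rule smooth_compose_scaleR[OF w(1)])
  have test: "g \<in> test_functions \<Omega>" "p \<in> test_functions \<Omega>" "q \<in> test_functions \<Omega>"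
    unfolding g_def[abs_def] p_def[abs_def] q_def[abs_def]
    by (intro test_functions_cnj test_functions_mult_smooth test_functions_partial_deriv
        smooth_compose_scaleR smooth_partial_deriv \<phi> we w)+
  then have L: "g \<in> L2 \<Omega>" "p \<in> L2 \<Omega>" "q \<in> L2 \<Omega>"
    using test_functions_L2 \<open>open \<Omega>\<close> by blast+
  have gL: "(L2_norm \<Omega> g)\<^sup>2 \<le> M\<^sup>2 * (L2_norm \<Omega> \<phi>)\<^sup>2"
    using L(1) w(2) by (intro L2_mono(2) test_functions_L2 \<phi> \<open>open \<Omega>\<close>)
      (auto simp: L2_def g_def we_def norm_mult mult.commute[of M] intro: mult_left_mono)
  have pL: "(L2_norm \<Omega> p)\<^sup>2 \<le> M\<^sup>2 * (L2_norm \<Omega> (partial_deriv i \<phi>))\<^sup>2"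
    using L(2) w(2) by (intro L2_mono(2) test_functions_L2 test_functions_partial_deriv \<phi> \<open>open \<Omega>\<close>)
      (auto simp: L2_def p_def we_def norm_mult mult.commute[of M] intro: mult_left_mono)
  have uL: "u \<in> L2 \<Omega>" using u by (simp add: H1_def)
  have GL: "G \<in> L2 \<Omega>" using weak_gradient[OF u] by (simp add: is_weak_gradient_def G_def)
  have "(\<lambda>v :: complex ^ 'd. v $ i) \<in> borel_measurable borel"
    by (intro borel_measurable_continuous_onI continuous_intros)
  then have Gm: "(\<lambda>x. G x $ i) \<in> borel_measurable (lebesgue_on \<Omega>)"
    using GL by (auto simp: L2_def)
  have Gi: "(\<lambda>x. G x $ i) \<in> L2 \<Omega>" "(L2_norm \<Omega> (\<lambda>x. G x $ i))\<^sup>2 \<le> 1\<^sup>2 * (L2_norm \<Omega> G)\<^sup>2"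
    using L2_mono[OF GL Gm, of 1] by (simp_all add: Finite_Cartesian_Product.norm_nth_le)
  have pd: "partial_deriv i g x = p x + inverse e *\<^sub>R q x" for x
  proof -
    have "(we has_derivative (\<lambda>h. of_real (inverse e) * frechet_derivative w (at (x /\<^sub>R e)) h)) (at x)"
      unfolding we_def[abs_def]
      by (rule has_derivative_compose_scaleR) (use smooth_has_derivative[OF w(1)] in \<open>auto simp: differentiable_def\<close>)
    then have "(g has_derivative (\<lambda>h. cnj (\<phi> x * (of_real (inverse e) * frechet_derivative w (at (x /\<^sub>R e)) h)
        + frechet_derivative \<phi> (at x) h * we x))) (at x)"
      unfolding g_def[abs_def]
      by (intro has_derivative_cnj has_derivative_mult smooth_has_derivative test_functions_smooth[OF \<phi>])
    from partial_deriv_at[OF this] show ?thesis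
      by (simp add: p_def q_def partial_deriv_def scaleR_conv_of_real)
  qed
  have "(LINT x|lebesgue_on \<Omega>. u x * partial_deriv i g x) = - (LINT x|lebesgue_on \<Omega>. G x $ i * g x)"
    using weak_gradient[OF u] test(1) by (simp add: is_weak_gradient_def G_def)
  moreover have "(LINT x|lebesgue_on \<Omega>. u x * partial_deriv i g x)
      = (LINT x|lebesgue_on \<Omega>. u x * p x) + inverse e *\<^sub>R (LINT x|lebesgue_on \<Omega>. u x * q x)"
    using L2_mult(1)[OF uL L(2)] L2_mult(1)[OF uL L(3)] by (simp add: pd distrib_left)
  ultimately have eq: "(LINT x|lebesgue_on \<Omega>. u x * p x) + inverse e *\<^sub>R (LINT x|lebesgue_on \<Omega>. u x * q x)
      = - (LINT x|lebesgue_on \<Omega>. G x $ i * g x)" by simp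
  \<comment> \<open>Multiplication by \<open>e\<close> isolates the \<open>q\<close> integral; the
    bracket is then replaced through integration by parts.\<close>
  have "(LINT x|lebesgue_on \<Omega>. u x * q x)
      = e *\<^sub>R ((LINT x|lebesgue_on \<Omega>. u x * p x) + inverse e *\<^sub>R (LINT x|lebesgue_on \<Omega>. u x * q x))
        - e *\<^sub>R (LINT x|lebesgue_on \<Omega>. u x * p x)"
    using \<open>e > 0\<close> by (simp add: scaleR_add_right)
  then have "(LINT x|lebesgue_on \<Omega>. u x * q x)
      = - (e *\<^sub>R ((LINT x|lebesgue_on \<Omega>. G x $ i * g x) + (LINT x|lebesgue_on \<Omega>. u x * p x)))"
    unfolding eq by (simp add: scaleR_add_right)
  then have "norm (LINT x|lebesgue_on \<Omega>. u x * q x)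
      = e * norm ((LINT x|lebesgue_on \<Omega>. G x $ i * g x) + (LINT x|lebesgue_on \<Omega>. u x * p x))"
    using \<open>e > 0\<close> by simp
  also have "\<dots> \<le> e * (((L2_norm \<Omega> (\<lambda>x. G x $ i))\<^sup>2 + (L2_norm \<Omega> g)\<^sup>2) / 2
      + ((L2_norm \<Omega> u)\<^sup>2 + (L2_norm \<Omega> p)\<^sup>2) / 2)"
    using \<open>e > 0\<close> L2_mult(2)[OF Gi(1) L(1)] L2_mult(2)[OF uL L(2)]
    by (intro mult_left_mono norm_triangle_le add_mono) auto
  also have "\<dots> \<le> e * (((L2_norm \<Omega> G)\<^sup>2 + M\<^sup>2 * (L2_norm \<Omega> \<phi>)\<^sup>2) / 2
      + ((L2_norm \<Omega> u)\<^sup>2 + M\<^sup>2 * (L2_norm \<Omega> (partial_deriv i \<phi>))\<^sup>2) / 2)"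
    using \<open>e > 0\<close> gL pL Gi(2) by (intro mult_left_mono add_mono divide_right_mono) auto
  finally show ?thesis
    by (simp add: q_def[abs_def] G_def field_simps)
qed

section \<open>Passage to the limit\<close>

theorem proposition6:
  fixes \<Omega> :: "(real ^ 'd::finite) set"
    and a :: "real ^ 'd \<Rightarrow> complex ^ 'd ^ 'd"
    and \<nu> :: real
    and \<theta> :: "real ^ 'd"
    and \<epsilon> :: "nat \<Rightarrow> real"
    and f u :: "nat \<Rightarrow> real ^ 'd \<Rightarrow> complex"
    and f\<^sub>0 :: "(real ^ 'd) \<times> (real ^ 'd) \<Rightarrow> complex"
  assumes "open \<Omega>" and "connected \<Omega>" and "\<Omega> \<noteq> {}"
    and "\<nu> > 0" and "elliptic_periodic_matrix \<nu> a"
    and "\<And>n. \<epsilon> n > 0" and "\<epsilon> \<longlonglongrightarrow> 0"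
    and "\<And>i. 0 < \<theta> $ i \<and> \<theta> $ i < 2 * pi"
    and "two_scale_converges \<theta> \<Omega> \<epsilon> f f\<^sub>0"
    and "\<And>n. weak_solution \<Omega> (\<lambda>x. a (x /\<^sub>R \<epsilon> n)) (f n) (u n)"
  shows "two_scale_converges \<theta> \<Omega> \<epsilon> u (\<lambda>_. 0)"
proof -
  have \<Omega>: "\<Omega> \<in> sets lebesgue" using \<open>open \<Omega>\<close> by (simp add: lebesgue_openin borel_open)
  have u: "u n \<in> H1 \<Omega>" for n
    using assms(10) by (auto simp: weak_solution_def H10_def)
  obtain C where C: "\<And>n. L2_norm \<Omega> (f n) \<le> C" and f: "\<And>n. f n \<in> L2 \<Omega>"
    using assms(9) by (auto simp: two_scale_converges_def)
  have nonneg: "0 \<le> L2_norm \<Omega> h" for h :: "real ^ 'd \<Rightarrow> complex"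
    by (simp add: L2_norm_def)
  let ?P = "\<lambda>y. \<forall>\<xi>. cdot (a y *v \<xi>) (cnj_vec \<xi>) \<in> \<real> \<and>
        \<nu> * (norm \<xi>)\<^sup>2 \<le> Re (cdot (a y *v \<xi>) (cnj_vec \<xi>)) \<and>
        Re (cdot (a y *v \<xi>) (cnj_vec \<xi>)) \<le> inverse \<nu> * (norm \<xi>)\<^sup>2"
  \<comment> \<open>The predicate depends on \<open>y\<close> only through \<open>a y\<close>, so it
    inherits periodicity, and ellipticity spreads from the cell to almost all of space.\<close>
  have "cell_periodic ?P" and am: "a \<in> borel_measurable lebesgue"
    and "AE y in lebesgue_on unit_cell. ?P y"
    using assms(5) by (auto simp: elliptic_periodic_matrix_def cell_periodic_def)
  then have ell: "AE y in lebesgue. ?P y"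
    by (intro cell_periodic_AE)
  have energy: "2 * \<nu> * (L2_norm \<Omega> (weak_gradient \<Omega> (u n)))\<^sup>2 + (L2_norm \<Omega> (u n))\<^sup>2 \<le> C\<^sup>2" for n
  proof -
    have "(\<lambda>x. a (x /\<^sub>R \<epsilon> n)) \<in> borel_measurable (lebesgue_on \<Omega>)"
      using measurable_compose[OF lebesgue_measurable_scaling am] by (rule measurable_restrict_space1)
    then have "2 * \<nu> * (L2_norm \<Omega> (weak_gradient \<Omega> (u n)))\<^sup>2 + (L2_norm \<Omega> (u n))\<^sup>2 \<le> (L2_norm \<Omega> (f n))\<^sup>2"
      by (intro weak_solution_energy_bound[OF assms(10) f] AE_lebesgue_on_scaleR[OF ell] assms \<Omega>)
    also have "\<dots> \<le> C\<^sup>2"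
      using C nonneg by (intro power_mono) auto
    finally show ?thesis .
  qed
  have ub: "(L2_norm \<Omega> (u n))\<^sup>2 \<le> C\<^sup>2" for n
    using energy[of n] \<open>\<nu> > 0\<close> by (smt (verit) mult_nonneg_nonneg zero_le_power2)
  have Gb: "(L2_norm \<Omega> (weak_gradient \<Omega> (u n)))\<^sup>2 \<le> C\<^sup>2 / (2 * \<nu>)" for n
    using energy[of n] \<open>\<nu> > 0\<close> by (simp add: pos_le_divide_eq mult.commute) (smt (verit) zero_le_power2)
  have "0 \<le> C" using nonneg C order_trans by blast
  have "(\<lambda>n. LINT x|lebesgue_on \<Omega>. u n x * cnj (\<phi> x * \<omega> (x /\<^sub>R \<epsilon> n))) \<longlonglongrightarrow> 0"
    if \<phi>: "\<phi> \<in> test_functions \<Omega>" and \<omega>: "\<omega> \<in> quasi_periodic_smooth \<theta>" for \<phi> \<omega>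
  proof -
    \<comment> \<open>One coordinate direction is fixed; the index type is nonempty, reflecting
      dimension at least one.\<close>
    fix i :: 'd
    obtain w M where w: "smooth w" "\<And>y. norm (w y) \<le> M" and "partial_deriv i w = \<omega>"
      using quasi_periodic_smooth_antiderivative[OF \<omega>] assms(8) by metis
    \<comment> \<open>This constant is independent of \<open>n\<close>: the energy estimate bounds
      \<open>u n\<close> and its gradient uniformly, and \<open>w\<close> and \<phi> are
      fixed.\<close>
    let ?K = "(C\<^sup>2 / (2 * \<nu>) + C\<^sup>2 + M\<^sup>2 * ((L2_norm \<Omega> \<phi>)\<^sup>2 + (L2_norm \<Omega> (partial_deriv i \<phi>))\<^sup>2)) / 2"
    have "norm (LINT x|lebesgue_on \<Omega>. u n x * cnj (\<phi> x * \<omega> (x /\<^sub>R \<epsilon> n))) \<le> \<epsilon> n * ?K" for n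
    proof -
      have "norm (LINT x|lebesgue_on \<Omega>. u n x * cnj (\<phi> x * \<omega> (x /\<^sub>R \<epsilon> n)))
        \<le> \<epsilon> n * (((L2_norm \<Omega> (weak_gradient \<Omega> (u n)))\<^sup>2 + (L2_norm \<Omega> (u n))\<^sup>2
        + M\<^sup>2 * ((L2_norm \<Omega> \<phi>)\<^sup>2 + (L2_norm \<Omega> (partial_deriv i \<phi>))\<^sup>2)) / 2)"
        using oscillating_integral_bound[where i=i, OF assms(1) u \<phi> w assms(6)]
        by (simp add: \<open>partial_deriv i w = \<omega>\<close>)
      also have "\<dots> \<le> \<epsilon> n * ?K"
        using ub Gb assms(6) by (intro mult_left_mono divide_right_mono add_mono) (auto simp: less_imp_le)
      finally show ?thesis .
    qed
    then have "\<forall>\<^sub>F n in sequentially.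
        norm (LINT x|lebesgue_on \<Omega>. u n x * cnj (\<phi> x * \<omega> (x /\<^sub>R \<epsilon> n))) \<le> \<epsilon> n * ?K"
      by (rule always_eventually[OF allI])
    moreover have "(\<lambda>n. \<epsilon> n * ?K) \<longlonglongrightarrow> 0"
      using tendsto_mult_left_zero[OF assms(7)] .
    ultimately show ?thesis
      by (rule Lim_null_comparison)
  qed
  moreover have "L2_norm \<Omega> (u n) \<le> C" for n
    using ub[of n] \<open>0 \<le> C\<close> by (rule power2_le_imp_le)
  moreover have "u n \<in> L2 \<Omega>" for n
    using u[of n] by (simp add: H1_def)
  \<comment> \<open>For the zero limit function the double integral on the right is 0.\<close>
  ultimately show ?thesis
    unfolding two_scale_converges_def by (auto simp: L2_def)
qed

end
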